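(* Let $X$ be a non-empty metrizable, separable, locally compact space and let $\mathcal F=\{f_1,\dots,f_m\}$ be an iterated function system on $X$. Then $\mathcal F$ has compact dynamics if and only if its Hutchinson map $H_{\mathcal F}:\mathcal K(X)\to\mathcal K(X)$ has compact dynamics. Moreover, in this case, if $\mathcal G_{\mathcal F}\subset X$ denotes the global attractor of $\mathcal F$ and $\mathcal H_{\mathcal F}\subset\mathcal K(X)$ the global attractor of $H_{\mathcal F}$, then $$\mathcal G_{\mathcal F}\in\mathcal H_{\mathcal F}\subset\mathcal K(\mathcal G_{\mathcal F}).$$ In particular, $\mathcal G_{\mathcal F}=\bigcup_{A\in\mathcal H_{\mathcal F}}A$. Finally, if $\mathcal G_{\mathcal F}$ is connected, then so is $\mathcal H_{\mathcal F}$.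
   Context: Fix a metric $d$ on $X$ compatible with its topology. An iterated function system (IFS) on a metrizable space $Y$ is a finite collection $\mathcal F=\{f_1,\dots,f_m\}$, $m\ge1$, of continuous maps $Y\to Y$. $\mathcal I^m$ is the set of all finite words in the letters $1,\dots,m$ (including the empty word $0$); $|I|$ is the length of $I$. For $I=i_1\cdots i_k$, $\Phi^I_{\mathcal F}=f_{i_k}\circ\dots\circ f_{i_1}$, and $\Phi^0_{\mathcal F}=\mathrm{id}$. For $A\subset Y$, $H_{\mathcal F}(A)=\bigcup_{i=1}^m f_i(A)$; $A$ is $H$-invariant if $H_{\mathcal F}(A)=A$. $N_\varepsilon(A)=\{x:d(x,A)<\varepsilon\}$, with $d(x,A)=\inf_{a\in A}d(x,a)$ and $\inf\emptyset=+\infty$. $A$ attracts $K$ if for every $\varepsilon>0$ there is $\tau>0$ with $\Phi^I_{\mathcal F}(K)\subset N_\varepsilon(A)$ for every $|I|\ge\tau$. A global attractor is a compact $H$-invariant set that attracts every compact subset of the phase space; it is unique if it exists. $\mathcal F$ has compact dynamics if it has a global attractor. $\mathcal K(X)$ is the space of all non-empty compact subsets of $X$ with the Hausdorff metric $d_H(A,B)=\max\{\sup_{a\in A}d(a,B),\sup_{b\in B}d(b,A)\}$; for $G\subset X$ compact, $\mathcal K(G)$ is the set of non-empty compact subsets of $G$. The Hutchinson map is $H_{\mathcal F}(K)=\bigcup_{i=1}^m f_i(K)$, $K\in\mathcal K(X)$. Compact dynamics and global attractor of the single continuous map $H_{\mathcal F}$ on $\mathcal K(X)$ are those of the IFS $\{H_{\mathcal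 F}\}$ with one generator on the metric space $(\mathcal K(X),d_H)$ (so the global attractor is a compact subset of $\mathcal K(X)$ mapped onto itself by $H_{\mathcal F}$ and attracting every compact subset of $\mathcal K(X)$). *)

theory Defs
  imports "HOL-Analysis.Analysis"
begin

section \<open>Iterated function systems and their global attractors\<close>

text \<open>
  The phase space is the universe of a type of class \<open>metric_space\<close>; its metric is the fixed
  metric \<open>d\<close>. A finite collection of maps \<open>f\<^sub>1, \<dots>, f\<^sub>m\<close> is given by \<open>m\<close> and an indexed
  family \<open>f\<close>, of which only the values at \<open>1, \<dots>, m\<close> matter.
\<close>

definition IFS :: "nat \<Rightarrow> (nat \<Rightarrow> 'a::metric_space \<Rightarrow> 'a) \<Rightarrow> bool" where
  "IFS m f \<longleftrightarrow> 1 \<le> m \<and> (\<forall>i\<in>{1..m}. continuous_on UNIV (f i))"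

definition words :: "nat \<Rightarrow> nat list set" where
  "words m = lists {1..m}"

text \<open>The first letter of a word acts first.\<close>

fun word_map :: "(nat \<Rightarrow> 'a \<Rightarrow> 'a) \<Rightarrow> nat list \<Rightarrow> 'a \<Rightarrow> 'a" where
  "word_map f [] = id"
| "word_map f (i # I) = word_map f I \<circ> f i"

definition hutchinson :: "nat \<Rightarrow> (nat \<Rightarrow> 'a \<Rightarrow> 'a) \<Rightarrow> 'a set \<Rightarrow> 'a set" where
  "hutchinson m f A = (\<Union>i\<in>{1..m}. f i ` A)"

text \<open>
  Extended real values are used because the distance to the empty set is infinite, whereas
  \<^const>\<open>infdist\<close> would give 0.
\<close>

definition point_dist :: "'a::metric_space \<Rightarrow> 'a set \<Rightarrow> ereal" where
  "point_dist x A = (INF a\<in>A. ereal (dist x a))"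

definition nbhd :: "real \<Rightarrow> 'a::metric_space set \<Rightarrow> 'a set" where
  "nbhd \<epsilon> A = {x. point_dist x A < ereal \<epsilon>}"

definition attracts ::
  "nat \<Rightarrow> (nat \<Rightarrow> 'a::metric_space \<Rightarrow> 'a) \<Rightarrow> 'a set \<Rightarrow> 'a set \<Rightarrow> bool" where
  "attracts m f A K \<longleftrightarrow>
     (\<forall>\<epsilon>>0. \<exists>\<tau>>0. \<forall>I\<in>words m. \<tau> \<le> length I \<longrightarrow> word_map f I ` K \<subseteq> nbhd \<epsilon> A)"

definition global_attractor ::
  "nat \<Rightarrow> (nat \<Rightarrow> 'a::metric_space \<Rightarrow> 'a) \<Rightarrow> 'a set \<Rightarrow> bool" where
  "global_attractor m f A \<longleftrightarrow>
     compact A \<and> hutchinson m f A = A \<and> (\<forall>K. compact K \<longrightarrow> attracts m f A K)"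

definition compact_dynamics :: "nat \<Rightarrow> (nat \<Rightarrow> 'a::metric_space \<Rightarrow> 'a) \<Rightarrow> bool" where
  "compact_dynamics m f \<longleftrightarrow> (\<exists>A. global_attractor m f A)"

lemma nbhd_iff: "x \<in> nbhd \<epsilon> A \<longleftrightarrow> (\<exists>a\<in>A. dist x a < \<epsilon>)"
  by (simp add: nbhd_def point_dist_def INF_less_iff)


section \<open>The hyperspace of non-empty compact sets\<close>

definition hausdorff_dist :: "'a::metric_space set \<Rightarrow> 'a set \<Rightarrow> real" where
  "hausdorff_dist A B = max (SUP a\<in>A. infdist a B) (SUP b\<in>B. infdist b A)"

lemma infdist_less_iff:
  assumes "B \<noteq> {}"
  shows "infdist a B < e \<longleftrightarrow> (\<exists>b\<in>B. dist a b < e)"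
  using assms by (simp add: infdist_notempty cINF_less_iff)

lemma SUP_infdist_less_iff:
  assumes "compact A" "A \<noteq> {}"
  shows "(SUP a\<in>A. infdist a B) < e \<longleftrightarrow> (\<forall>a\<in>A. infdist a B < e)"
proof -
  have cont: "continuous_on A (\<lambda>a. infdist a B)"
    by (intro continuous_intros)
  have bdd: "bdd_above ((\<lambda>a. infdist a B) ` A)"
    using compact_continuous_image[OF cont assms(1)]
    by (simp add: bounded_imp_bdd_above compact_imp_bounded)
  obtain x where x: "x \<in> A" "\<And>a. a \<in> A \<Longrightarrow> infdist a B \<le> infdist x B"
    using continuous_attains_sup[OF assms cont] by blast
  have "(SUP a\<in>A. infdist a B) \<le> infdist x B"
    using x assms(2) by (intro cSUP_least) auto
  moreover have "infdist a B \<le> (SUP a\<in>A. infdist a B)" if "a \<in> A" for a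
    using that bdd by (rule cSUP_upper)
  ultimately show ?thesis
    using x(1) by (meson order.strict_trans1)
qed

lemma hausdorff_dist_less_iff:
  assumes "compact A" "A \<noteq> {}" "compact B" "B \<noteq> {}"
  shows "hausdorff_dist A B < e \<longleftrightarrow>
    (\<forall>a\<in>A. \<exists>b\<in>B. dist a b < e) \<and> (\<forall>b\<in>B. \<exists>a\<in>A. dist a b < e)"
  unfolding hausdorff_dist_def max_less_iff_conj
  using assms by (simp add: SUP_infdist_less_iff infdist_less_iff dist_commute)

typedef (overloaded) 'a hyperspace = "{K :: 'a::metric_space set. K \<noteq> {} \<and> compact K}"
  morphisms set_of Abs_hyperspace
  by (rule exI[of _ "{undefined}"]) simp

lemma set_of_nonempty [simp]: "set_of K \<noteq> {}"
  and compact_set_of [simp]: "compact (set_of K)"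
  using set_of[of K] by auto

instantiation hyperspace :: (metric_space) metric_space
begin

definition dist_hyperspace :: "'a hyperspace \<Rightarrow> 'a hyperspace \<Rightarrow> real" where
  "dist_hyperspace K L = hausdorff_dist (set_of K) (set_of L)"

definition uniformity_hyperspace :: "('a hyperspace \<times> 'a hyperspace) filter" where
  "uniformity_hyperspace = (INF e\<in>{0<..}. principal {(x, y). dist x y < e})"

definition open_hyperspace :: "'a hyperspace set \<Rightarrow> bool" where
  "open_hyperspace S \<longleftrightarrow> (\<forall>x\<in>S. \<forall>\<^sub>F (x', y) in uniformity. x' = x \<longrightarrow> y \<in> S)"

lemma dist_hyperspace_less_iff:
  fixes K L :: "'a hyperspace"
  shows "dist K L < e \<longleftrightarrow>
    (\<forall>a\<in>set_of K. \<exists>b\<in>set_of L. dist a b < e) \<and> (\<forall>b\<in>set_of L. \<exists>a\<in>set_of K. dist a b < e)"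
  unfolding dist_hyperspace_def by (intro hausdorff_dist_less_iff) simp_all

instance
proof
  fix K L M :: "'a hyperspace"
  have close: "x \<in> set_of B" if "\<And>e. e > 0 \<Longrightarrow> \<exists>b\<in>set_of B. dist x b < e"
    for x and B :: "'a hyperspace"
  proof -
    have "x \<in> closure (set_of B)"
      unfolding closure_approachable using that by (simp add: dist_commute)
    then show ?thesis
      by (simp add: compact_imp_closed)
  qed
  show "dist K L = 0 \<longleftrightarrow> K = L"
  proof
    assume 0: "dist K L = 0"
    then have less: "dist K L < e" if "e > 0" for e
      using that by simp
    have "set_of K = set_of L"
    proof (intro equalityI subsetI)
      fix x assume x: "x \<in> set_of K"
      show "x \<in> set_of L"
        by (rule close) (use less x in \<open>auto simp: dist_hyperspace_less_iff\<close>)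
    next
      fix x assume x: "x \<in> set_of L"
      show "x \<in> set_of K"
        by (rule close) (use less x in \<open>auto simp: dist_hyperspace_less_iff dist_commute[of x]\<close>)
    qed
    then show "K = L"
      by (simp add: set_of_inject)
  next
    assume "K = L"
    then show "dist K L = 0"
      by (simp add: dist_hyperspace_def hausdorff_dist_def cong: SUP_cong)
  qed
  show "dist K L \<le> dist K M + dist L M"
  proof (rule field_le_epsilon)
    fix e :: real assume e: "e > 0"
    define r where "r = dist K M + e / 2"
    define s where "s = dist L M + e / 2"
    have "dist K M < r" "dist L M < s"
      using e by (simp_all add: r_def s_def)
    then have K: "\<forall>a\<in>set_of K. \<exists>c\<in>set_of M. dist a c < r"
      and K': "\<forall>c\<in>set_of M. \<exists>a\<in>set_of K. dist a c < r"
      and L: "\<forall>b\<in>set_of L. \<exists>c\<in>set_of M. dist b c < s"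
      and L': "\<forall>c\<in>set_of M. \<exists>b\<in>set_of L. dist b c < s"
      unfolding dist_hyperspace_less_iff by blast+
    have tri: "dist a b < r + s" if "dist a c < r" "dist b c < s" for a b c :: 'a
      using dist_triangle2[of a b c] that by linarith
    have "dist K L < r + s"
      unfolding dist_hyperspace_less_iff by (meson tri K K' L L')
    then show "dist K L \<le> dist K M + dist L M + e"
      by (simp add: r_def s_def)
  qed
qed (rule uniformity_hyperspace_def open_hyperspace_def)+

end

text \<open>
  The value is the intended one whenever \<open>hutchinson m f\<close> maps non-empty compact sets to
  non-empty compact sets, in particular for every \<open>IFS m f\<close> by \<open>set_of_hutchinson_map\<close> below.
\<close>

definition hutchinson_map ::
  "nat \<Rightarrow> (nat \<Rightarrow> 'a::metric_space \<Rightarrow> 'a) \<Rightarrow> 'a hyperspace \<Rightarrow> 'a hyperspace" where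
  "hutchinson_map m f K = Abs_hyperspace (hutchinson m f (set_of K))"

definition hyper_subsets :: "'a::metric_space set \<Rightarrow> 'a hyperspace set" where
  "hyper_subsets G = {K. set_of K \<subseteq> G}"

lemma set_of_hutchinson_map:
  assumes "IFS m f"
  shows "set_of (hutchinson_map m f K) = hutchinson m f (set_of K)"
proof -
  have "compact (hutchinson m f (set_of K))"
    unfolding hutchinson_def
    using assms
    by (intro compact_UN compact_continuous_image)
      (auto simp: IFS_def intro: continuous_on_subset[OF _ subset_UNIV])
  moreover have "hutchinson m f (set_of K) \<noteq> {}"
    using assms by (auto simp: hutchinson_def IFS_def)
  ultimately show ?thesis
    unfolding hutchinson_map_def by (simp add: Abs_hyperspace_inverse)
qed

lemma uniformly_close_on_compact:
  fixes g :: "'a::metric_space \<Rightarrow> 'b::metric_space"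
  assumes "continuous_on UNIV g" "compact K" "e > 0"
  shows "\<exists>d>0. \<forall>x\<in>K. \<forall>y. dist x y < d \<longrightarrow> dist (g x) (g y) < e"
proof -
  let ?G = "range (\<lambda>z. g -` ball z (e / 2))"
  have cov: "K \<subseteq> \<Union>?G"
  proof
    fix x assume "x \<in> K"
    have "x \<in> g -` ball (g x) (e / 2)"
      using assms(3) by simp
    then show "x \<in> \<Union>?G"
      by blast
  qed
  have op: "open G" if "G \<in> ?G" for G
    using that assms(1) by (auto intro: open_vimage)
  obtain d where d: "d > 0" "\<forall>x\<in>K. \<exists>G\<in>?G. ball x d \<subseteq> G"
    using Heine_Borel_lemma[OF assms(2) cov op] by metis
  have "dist (g x) (g y) < e" if xy: "x \<in> K" "dist x y < d" for x y
  proof -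
    obtain z where "ball x d \<subseteq> g -` ball z (e / 2)"
      using d(2) xy(1) by blast
    moreover have "x \<in> ball x d" "y \<in> ball x d"
      using d(1) xy(2) by auto
    ultimately have "g x \<in> ball z (e / 2)" "g y \<in> ball z (e / 2)"
      by blast+
    then have "dist z (g x) < e / 2" "dist z (g y) < e / 2"
      by (simp_all only: mem_ball)
    then show ?thesis
      using dist_triangle3[of "g x" "g y" z] by linarith
  qed
  with d(1) show ?thesis
    by blast
qed

text \<open>The Hutchinson map is continuous, so it is an IFS with one generator.\<close>

lemma IFS_hutchinson_map:
  assumes "IFS m f"
  shows "IFS 1 (\<lambda>_. hutchinson_map m f)"
proof -
  have "\<exists>d>0. \<forall>L. dist L K < d \<longrightarrow> dist (hutchinson_map m f L) (hutchinson_map m f K) < e"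
    if e: "e > 0" for K e
  proof -
    have "\<forall>i\<in>{1..m}. \<exists>d>0. \<forall>x\<in>set_of K. \<forall>y. dist x y < d \<longrightarrow> dist (f i x) (f i y) < e"
      using assms e by (auto simp: IFS_def intro!: uniformly_close_on_compact)
    then obtain d where d: "\<And>i. i \<in> {1..m} \<Longrightarrow> d i > 0"
      "\<And>i x y. i \<in> {1..m} \<Longrightarrow> x \<in> set_of K \<Longrightarrow> dist x y < d i \<Longrightarrow> dist (f i x) (f i y) < e"
      by metis
    define \<delta> where "\<delta> = Min (d ` {1..m})"
    have ne: "d ` {1..m} \<noteq> {}"
      using assms by (simp add: IFS_def)
    have pos: "\<delta> > 0"
      unfolding \<delta>_def using d(1) ne by (subst Min_gr_iff) auto
    have le: "\<delta> \<le> d i" if "i \<in> {1..m}" for i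
      unfolding \<delta>_def using that by (intro Min_le) auto
    have close: "dist (f i y) (f i x) < e"
      if "i \<in> {1..m}" "x \<in> set_of K" "dist y x < \<delta>" for i x y
      using d(2)[of i x y] that le[of i] by (simp add: dist_commute)
    have "dist (hutchinson_map m f L) (hutchinson_map m f K) < e" if "dist L K < \<delta>" for L
    proof -
      have L: "\<forall>y\<in>set_of L. \<exists>x\<in>set_of K. dist y x < \<delta>"
        and K: "\<forall>x\<in>set_of K. \<exists>y\<in>set_of L. dist y x < \<delta>"
        using that unfolding dist_hyperspace_less_iff by blast+
      show ?thesis
        unfolding dist_hyperspace_less_iff set_of_hutchinson_map[OF assms] hutchinson_def
      proof (intro conjI ballI)
        fix a assume "a \<in> (\<Union>i\<in>{1..m}. f i ` set_of L)"
        then obtain i y where iy: "i \<in> {1..m}" "y \<in> set_of L" "a = f i y"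
          by blast
        obtain x where x: "x \<in> set_of K" "dist y x < \<delta>"
          using L iy(2) by blast
        show "\<exists>b\<in>\<Union>i\<in>{1..m}. f i ` set_of K. dist a b < e"
          using close[OF iy(1) x] iy x by blast
      next
        fix b assume "b \<in> (\<Union>i\<in>{1..m}. f i ` set_of K)"
        then obtain i x where ix: "i \<in> {1..m}" "x \<in> set_of K" "b = f i x"
          by blast
        obtain y where y: "y \<in> set_of L" "dist y x < \<delta>"
          using K ix(2) by blast
        show "\<exists>a\<in>\<Union>i\<in>{1..m}. f i ` set_of L. dist a b < e"
          using close[OF ix(1,2) y(2)] ix y by blast
      qed
    qed
    with pos show ?thesis
      by blast
  qed
  then show ?thesis
    by (simp add: IFS_def continuous_on_iff)
qed

end

theory Submission
  imports Defs
begin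

text \<open>
  If \<open>G\<close> is the global attractor of the system, then \<open>\<K>(G)\<close> is a compact forward invariant set of
  the Hutchinson map \<open>H\<close> that attracts every compact family, because a set close to being contained
  in \<open>G\<close> is Hausdorff close to a subset of \<open>G\<close>; hence \<open>\<Inter>n. H\<^sup>n(\<K>(G))\<close> is a global attractor of \<open>H\<close>.
  Conversely, the union of a global attractor of \<open>H\<close> is compact, invariant and attracting. The
  inclusions between the two attractors hold since an invariant set lies in every closed set that
  attracts it. For connectedness, \<open>\<K>(G)\<close> is connected, so the connected sets \<open>H\<^sup>n(\<K>(G))\<close> contain
  the attractor of \<open>H\<close> and are eventually contained in any given neighbourhood of it.
\<close>

section \<open>Attraction in terms of iterates\<close>

text \<open>Since the first letter acts first, a word of length \<open>Suc n\<close> is split at its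
  head, which matches splitting the innermost application off the iterate. The induction therefore
  runs over all \<open>K\<close>.\<close>

lemma funpow_hutchinson:
  "(hutchinson m f ^^ n) K = (\<Union>I\<in>{I \<in> words m. length I = n}. word_map f I ` K)"
proof (induction n arbitrary: K)
  case 0
  have "{I \<in> words m. length I = 0} = {[]}"
    by (auto simp: words_def)
  then show ?case
    by simp
next
  case (Suc n)
  have "{I \<in> words m. length I = Suc n} = (\<Union>i\<in>{1..m}. (#) i ` {I \<in> words m. length I = n})"
    by (fastforce simp: words_def length_Suc_conv)
  moreover have "(hutchinson m f ^^ Suc n) K = (hutchinson m f ^^ n) (hutchinson m f K)"
    by (simp only: funpow_Suc_right o_apply)
  ultimately show ?case
    by (simp add: Suc.IH) (auto simp: hutchinson_def)
qed

lemma attracts_iff_funpow: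
  "attracts m f A K \<longleftrightarrow> (\<forall>\<epsilon>>0. \<exists>N. \<forall>n\<ge>N. (hutchinson m f ^^ n) K \<subseteq> nbhd \<epsilon> A)"
proof -
  have "(\<exists>\<tau>>0. \<forall>I\<in>words m. \<tau> \<le> length I \<longrightarrow> word_map f I ` K \<subseteq> nbhd \<epsilon> A) \<longleftrightarrow>
    (\<exists>N. \<forall>n\<ge>N. (hutchinson m f ^^ n) K \<subseteq> nbhd \<epsilon> A)" (is "?L \<longleftrightarrow> ?R") for \<epsilon>
  proof
    assume ?L
    then obtain \<tau> where "\<forall>I\<in>words m. \<tau> \<le> length I \<longrightarrow> word_map f I ` K \<subseteq> nbhd \<epsilon> A"
      by blast
    then have "\<forall>n\<ge>\<tau>. (hutchinson m f ^^ n) K \<subseteq> nbhd \<epsilon> A"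
      unfolding funpow_hutchinson by blast
    then show ?R ..
  next
    assume ?R
    then obtain N where "\<forall>n\<ge>N. (hutchinson m f ^^ n) K \<subseteq> nbhd \<epsilon> A"
      by blast
    \<comment> \<open>\<open>attracts\<close> asks for a positive threshold, and \<open>N\<close>
      may be 0.\<close>
    then have "\<forall>I\<in>words m. Suc N \<le> length I \<longrightarrow> word_map f I ` K \<subseteq> nbhd \<epsilon> A"
      unfolding funpow_hutchinson using Suc_leD by blast
    then show ?L
      by blast
  qed
  then show ?thesis
    by (simp add: attracts_def)
qed

lemma hutchinson_single: "hutchinson 1 (\<lambda>_. h) = image h"
  by (auto simp: hutchinson_def)

lemma attracts_single_iff:
  "attracts 1 (\<lambda>_. h) A K \<longleftrightarrow> (\<forall>\<epsilon>>0. \<exists>N. \<forall>n\<ge>N. (h ^^ n) ` K \<subseteq> nbhd \<epsilon> A)"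
proof -
  have "(image h ^^ n) K = (h ^^ n) ` K" for n
    by (induction n) auto
  then show ?thesis
    by (simp only: attracts_iff_funpow hutchinson_single)
qed

lemma global_attractor_single_iff:
  "global_attractor 1 (\<lambda>_. h) A \<longleftrightarrow>
    compact A \<and> h ` A = A \<and> (\<forall>K. compact K \<longrightarrow> attracts 1 (\<lambda>_. h) A K)"
  by (simp only: global_attractor_def hutchinson_single)

lemma mono_hutchinson: "mono (hutchinson m f)"
  by (auto simp: mono_def hutchinson_def)

lemma funpow_fixed:
  assumes "g x = x"
  shows "(g ^^ n) x = x"
  using assms by (induction n) auto

text \<open>Iteration leaves \<open>K\<close> in place, so attraction puts \<open>K\<close> itself
  into every neighbourhood of \<open>A\<close>, hence into the closure of \<open>A\<close>.\<close>

lemma invariant_subset_attracting: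
  assumes "closed A" "hutchinson m f K = K" "attracts m f A K"
  shows "K \<subseteq> A"
proof
  fix x assume x: "x \<in> K"
  have "\<exists>a\<in>A. dist a x < \<epsilon>" if \<epsilon>: "\<epsilon> > 0" for \<epsilon>
  proof -
    obtain N where "(hutchinson m f ^^ N) K \<subseteq> nbhd \<epsilon> A"
      using assms(3) \<epsilon> unfolding attracts_iff_funpow by blast
    then have "x \<in> nbhd \<epsilon> A"
      using x assms(2) by (auto simp: funpow_fixed)
    then show ?thesis
      by (auto simp: nbhd_iff dist_commute)
  qed
  then have "x \<in> closure A"
    by (simp add: closure_approachable)
  with assms(1) show "x \<in> A"
    by simp
qed

section \<open>Attractors from compact attracting sets\<close>

text \<open>Otherwise the sets \<open>F n - U\<close> are compact, nested and non-empty, so they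
  share a point, which lies in every \<open>F n\<close> but not in \<open>U\<close>. The case
  \<open>U = {}\<close> is Cantor's intersection theorem and is applied in that form below.\<close>

lemma compact_decseq_subset_open:
  fixes F :: "nat \<Rightarrow> 'a::t2_space set"
  assumes F: "\<And>n. compact (F n)" "decseq F"
    and U: "open U" "(\<Inter>n. F n) \<subseteq> U"
  shows "\<exists>n. F n \<subseteq> U"
proof (rule ccontr)
  assume "\<nexists>n. F n \<subseteq> U"
  then have ne: "F n - U \<noteq> {}" for n
    by blast
  have "(F 0 - U) \<inter> (\<Inter>n\<in>UNIV. F n) \<noteq> {}"
  proof (rule compact_imp_fip_image)
    show "compact (F 0 - U)"
      using F(1) U(1) by (rule compact_diff)
    show "closed (F n)" for n
      by (intro compact_imp_closed F)
    fix I :: "nat set" assume I: "finite I"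
    \<comment> \<open>Inserting 0 gives \<open>Max\<close> a value for empty \<open>I\<close> and
      also ensures \<open>F k \<subseteq> F 0\<close>.\<close>
    define k where "k = Max (insert 0 I)"
    have "F k \<subseteq> F i" if "i \<in> insert 0 I" for i
      using that I by (intro decseqD[OF F(2)]) (simp add: k_def)
    then have "F k - U \<subseteq> (F 0 - U) \<inter> (\<Inter>i\<in>I. F i)"
      by blast
    then show "(F 0 - U) \<inter> (\<Inter>i\<in>I. F i) \<noteq> {}"
      using ne[of k] by blast
  qed
  with U(2) show False
    by blast
qed

lemma open_nbhd: "open (nbhd \<epsilon> A)"
proof -
  have "nbhd \<epsilon> A = (\<Union>a\<in>A. ball a \<epsilon>)"
    by (auto simp: nbhd_iff dist_commute)
  then show ?thesis
    by (simp add: open_UN)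
qed

lemma continuous_on_funpow:
  fixes h :: "'a::topological_space \<Rightarrow> 'a"
  assumes "continuous_on UNIV h"
  shows "continuous_on UNIV (h ^^ n)"
proof (induction n)
  case (Suc n)
  then show ?case
    using continuous_on_compose[OF Suc continuous_on_subset[OF assms]] by simp
qed (simp add: continuous_on_id)

text \<open>The images of \<open>C\<close> decrease, and their intersection is the omega-limit set
  of \<open>C\<close>. Cantor's theorem yields its invariance; attraction follows in two stages,
  from \<open>K\<close> to \<open>C\<close> and from \<open>C\<close> to the intersection.\<close>

lemma global_attractor_INT:
  fixes h :: "'a::metric_space \<Rightarrow> 'a"
  assumes h: "continuous_on UNIV h"
    and C: "compact C" "h ` C \<subseteq> C"
    and attr: "\<And>K. compact K \<Longrightarrow> attracts 1 (\<lambda>_. h) C K"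
  shows "global_attractor 1 (\<lambda>_. h) (\<Inter>n. (h ^^ n) ` C)"
proof -
  let ?A = "\<Inter>n. (h ^^ n) ` C"
  have comp: "compact ((h ^^ n) ` C)" for n
    using continuous_on_funpow[OF h] C(1)
    by (blast intro: compact_continuous_image continuous_on_subset)
  have "(h ^^ Suc n) ` C \<subseteq> (h ^^ n) ` C" for n
  proof -
    have "(h ^^ Suc n) ` C = (h ^^ n) ` h ` C"
      by (simp only: funpow_Suc_right image_comp)
    then show ?thesis
      using C(2) by blast
  qed
  then have dec: "decseq (\<lambda>n. (h ^^ n) ` C)"
    by (rule decseq_SucI)
  have A_comp: "compact ?A"
  proof -
    have "closed ?A"
      by (intro closed_INT ballI compact_imp_closed comp)
    then have "compact (C \<inter> ?A)"
      using C(1) by (rule compact_Int_closed[rotated])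
    moreover have "C \<inter> ?A = ?A"
      using INT_lower[of 0 UNIV "\<lambda>n. (h ^^ n) ` C"] by auto
    ultimately show ?thesis
      by simp
  qed
  have "h ` ?A = ?A"
  proof
    show "h ` ?A \<subseteq> ?A"
    proof clarify
      fix x n assume x: "x \<in> ?A"
      then have "x \<in> (h ^^ n) ` C"
        by blast
      then have "h x \<in> (h ^^ Suc n) ` C"
        by auto
      then show "h x \<in> (h ^^ n) ` C"
        using decseqD[OF dec, of n "Suc n"] by auto
    qed
    show "?A \<subseteq> h ` ?A"
    proof
      fix y assume y: "y \<in> ?A"
      \<comment> \<open>These are the preimages of \<open>y\<close> in the \<open>n\<close>-th
        image; there is one because \<open>y\<close> also lies in the next image. A point common to
        all of them is a preimage of \<open>y\<close> in \<open>?A\<close>.\<close>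
      let ?F = "\<lambda>n. (h ^^ n) ` C \<inter> h -` {y}"
      have "closed (h -` {y})"
        using closed_singleton h by (rule closed_vimage)
      then have Fc: "compact (?F n)" for n
        using comp by (rule compact_Int_closed[rotated])
      have Fd: "decseq ?F"
        using decseqD[OF dec] unfolding decseq_def by blast
      have Fn: "?F n \<noteq> {}" for n
      proof -
        have "y \<in> (h ^^ Suc n) ` C"
          using y by blast
        then show ?thesis
          by auto
      qed
      have "(\<Inter>n. ?F n) \<noteq> {}"
        using compact_decseq_subset_open[OF Fc Fd open_empty] Fn by blast
      then show "y \<in> h ` ?A"
        by blast
    qed
  qed
  moreover have "attracts 1 (\<lambda>_. h) ?A K" if K: "compact K" for K
    unfolding attracts_single_iff
  proof (intro allI impI)
    fix \<epsilon> :: real assume \<epsilon>: "\<epsilon> > 0"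
    \<comment> \<open>A fixed number \<open>N\<close> of steps brings \<open>C\<close> within
      \<open>\<epsilon> / 2\<close> of \<open>?A\<close>. By uniform continuity of
      \<open>h ^^ N\<close> at the points of \<open>C\<close>, an orbit within \<open>d\<close> of
      \<open>C\<close> follows up to another \<open>\<epsilon> / 2\<close>.\<close>
    have "?A \<subseteq> nbhd (\<epsilon> / 2) ?A"
      using \<epsilon> unfolding nbhd_iff subset_iff by (metis dist_self half_gt_zero)
    then obtain N where N: "(h ^^ N) ` C \<subseteq> nbhd (\<epsilon> / 2) ?A"
      using compact_decseq_subset_open[OF comp dec open_nbhd] by blast
    obtain d where d: "d > 0" "\<forall>x\<in>C. \<forall>y. dist x y < d \<longrightarrow> dist ((h ^^ N) x) ((h ^^ N) y) < \<epsilon> / 2"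
      using uniformly_close_on_compact[OF continuous_on_funpow[OF h] C(1), of "\<epsilon> / 2" N] \<epsilon> by auto
    obtain M where M: "\<And>n. n \<ge> M \<Longrightarrow> (h ^^ n) ` K \<subseteq> nbhd d C"
      using attr[OF K] d(1) unfolding attracts_single_iff by blast
    have "(h ^^ n) x \<in> nbhd \<epsilon> ?A" if n: "n \<ge> N + M" and x: "x \<in> K" for n x
    proof -
      have "(h ^^ (n - N)) x \<in> nbhd d C"
        using M[of "n - N"] n x by (simp add: image_subset_iff)
      then obtain c where c: "c \<in> C" "dist ((h ^^ (n - N)) x) c < d"
        by (auto simp: nbhd_iff)
      have "(h ^^ n) x = (h ^^ N) ((h ^^ (n - N)) x)"
        using n fun_cong[OF funpow_add[of N "n - N" h], of x] by simp
      then have 1: "dist ((h ^^ N) c) ((h ^^ n) x) < \<epsilon> / 2"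
        using d(2) c by (simp add: dist_commute)
      obtain a where a: "a \<in> ?A" "dist ((h ^^ N) c) a < \<epsilon> / 2"
        using N c(1) unfolding nbhd_iff subset_iff by blast
      have "dist ((h ^^ n) x) a < \<epsilon>"
        using 1 a(2) dist_triangle3[of "(h ^^ n) x" a "(h ^^ N) c"] by linarith
      with a(1) show ?thesis
        unfolding nbhd_iff by blast
    qed
    then show "\<exists>N. \<forall>n\<ge>N. (h ^^ n) ` K \<subseteq> nbhd \<epsilon> ?A"
      by blast
  qed
  ultimately show ?thesis
    using A_comp by (simp only: global_attractor_single_iff) blast
qed

section \<open>Compactness and connectedness in the hyperspace\<close>

lemma set_of_Abs_hyperspace:
  "compact A \<Longrightarrow> A \<noteq> {} \<Longrightarrow> set_of (Abs_hyperspace A) = A"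
  by (simp add: Abs_hyperspace_inverse)

text \<open>A compact subset of \<open>W\<close> has a uniform neighbourhood inside
  \<open>W\<close>. These are the basic open sets of the upper Vietoris topology.\<close>

lemma open_hyper_subsets:
  assumes "open W"
  shows "open (hyper_subsets W)"
  unfolding open_dist
proof
  fix K :: "'a hyperspace" assume "K \<in> hyper_subsets W"
  then have "set_of K \<subseteq> W"
    by (simp add: hyper_subsets_def)
  then obtain e where e: "e > 0" "(\<Union>x\<in>set_of K. ball x e) \<subseteq> W"
    using compact_subset_open_imp_ball_epsilon_subset[OF compact_set_of assms] by blast
  have "L \<in> hyper_subsets W" if "dist L K < e" for L
  proof -
    have "set_of L \<subseteq> (\<Union>x\<in>set_of K. ball x e)"
      using that by (auto simp: dist_hyperspace_less_iff dist_commute)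
    with e(2) show ?thesis
      by (auto simp: hyper_subsets_def)
  qed
  with e(1) show "\<exists>e>0. \<forall>L. dist L K < e \<longrightarrow> L \<in> hyper_subsets W"
    by blast
qed

text \<open>A finite subcover of one member \<open>K\<close> covers all members in a hyperspace
  neighbourhood of \<open>K\<close>, by \<open>open_hyper_subsets\<close>. Compactness of the family
  leaves finitely many such neighbourhoods.\<close>

lemma compact_UN_set_of:
  assumes "compact \<K>"
  shows "compact (\<Union>K\<in>\<K>. set_of K)"
proof (rule compactI)
  fix \<C> :: "'a set set"
  assume op: "\<forall>C\<in>\<C>. open C" and cov: "(\<Union>K\<in>\<K>. set_of K) \<subseteq> \<Union>\<C>"
  have "\<exists>D\<subseteq>\<C>. finite D \<and> set_of K \<subseteq> \<Union>D" if "K \<in> \<K>" for K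
    using compactE[OF compact_set_of, of K \<C>] op cov that by (metis UN_subset_iff)
  then obtain D where D: "\<And>K. K \<in> \<K> \<Longrightarrow> D K \<subseteq> \<C> \<and> finite (D K) \<and> set_of K \<subseteq> \<Union>(D K)"
    by metis
  have opD: "open (hyper_subsets (\<Union>(D K)))" if "K \<in> \<K>" for K
    using D[OF that] op by (intro open_hyper_subsets open_Union) blast
  have covD: "\<K> \<subseteq> (\<Union>K\<in>\<K>. hyper_subsets (\<Union>(D K)))"
    using D by (auto simp: hyper_subsets_def)
  obtain \<L> where \<L>: "\<L> \<subseteq> \<K>" "finite \<L>" "\<K> \<subseteq> (\<Union>K\<in>\<L>. hyper_subsets (\<Union>(D K)))"
    using compactE_image[OF assms opD covD] by metis
  have "(\<Union>K\<in>\<K>. set_of K) \<subseteq> \<Union>(\<Union>K\<in>\<L>. D K)"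
    using \<L>(3) unfolding hyper_subsets_def by blast
  moreover have "(\<Union>K\<in>\<L>. D K) \<subseteq> \<C>" "finite (\<Union>K\<in>\<L>. D K)"
    using D \<L>(1,2) by blast+
  ultimately show "\<exists>\<D>\<subseteq>\<C>. finite \<D> \<and> (\<Union>K\<in>\<K>. set_of K) \<subseteq> \<Union>\<D>"
    by blast
qed

section \<open>Compactness of the hyperspace of a compact set\<close>

lemma finite_subset_dist_less:
  assumes "finite k" "set_of K \<subseteq> (\<Union>x\<in>k. ball x e)"
  obtains s where "s \<subseteq> k" "s \<noteq> {}" "finite s" "dist (Abs_hyperspace s) K < e"
proof
  \<comment> \<open>Centres whose ball misses \<open>K\<close> may be far from \<open>K\<close> and
    would spoil the Hausdorff distance.\<close>
  let ?s = "{x \<in> k. \<exists>y\<in>set_of K. dist x y < e}"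
  show "?s \<subseteq> k" "finite ?s"
    using assms(1) by auto
  have K: "\<exists>x\<in>?s. dist x y < e" if "y \<in> set_of K" for y
    using assms(2) that by fastforce
  then show ne: "?s \<noteq> {}"
    using set_of_nonempty[of K] by blast
  have "set_of (Abs_hyperspace ?s) = ?s"
    using assms(1) ne by (intro set_of_Abs_hyperspace finite_imp_compact) auto
  then show "dist (Abs_hyperspace ?s) K < e"
    unfolding dist_hyperspace_less_iff using K by auto
qed

text \<open>The limit of a Cauchy sequence is its topological upper limit, the intersection
  \<open>L\<close> of the closures of its tails.\<close>

lemma complete_hyper_subsets:
  assumes G: "compact G"
  shows "complete (hyper_subsets G)"
  unfolding complete_def
proof (intro allI impI)
  fix X :: "nat \<Rightarrow> 'a hyperspace"
  assume X: "(\<forall>n. X n \<in> hyper_subsets G) \<and> Cauchy X"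
  define T where "T n = closure (\<Union>k\<in>{n..}. set_of (X k))" for n
  define L where "L = (\<Inter>n. T n)"
  have TG: "T n \<subseteq> G" for n
    unfolding T_def using X G
    by (intro closure_minimal compact_imp_closed) (auto simp: hyper_subsets_def)
  have Tc: "closed (T n)" for n
    by (simp add: T_def)
  have Td: "decseq T"
    unfolding T_def by (intro decseq_SucI closure_mono UN_mono) auto
  \<comment> \<open>A point close to all late terms is close to \<open>L\<close>: Cantor's theorem
    applies to the tails cut by a closed ball about \<open>a\<close>. Its radius
    \<open>e / 2\<close> leaves room for the strict bound.\<close>
  have near: "\<exists>b\<in>L. dist a b < e"
    if e: "e > 0" and N: "\<And>k. k \<ge> N \<Longrightarrow> \<exists>b\<in>set_of (X k). dist a b < e / 2" for a e N
  proof -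
    let ?F = "\<lambda>n. G \<inter> (T n \<inter> cball a (e / 2))"
    have Fc: "compact (?F n)" for n
      using G Tc by (intro compact_Int_closed closed_Int) auto
    have Fd: "decseq ?F"
      using decseqD[OF Td] unfolding decseq_def by blast
    have Fn: "?F n \<noteq> {}" for n
    proof -
      obtain b where b: "b \<in> set_of (X (max N n))" "dist a b < e / 2"
        using N[of "max N n"] by auto
      have "b \<in> (\<Union>k\<in>{n..}. set_of (X k))"
        using b(1) by (auto intro!: bexI[of _ "max N n"])
      then have "b \<in> T n"
        unfolding T_def by (rule subsetD[OF closure_subset])
      moreover have "b \<in> cball a (e / 2)"
        using b(2) by simp
      ultimately show ?thesis
        using TG by blast
    qed
    have "(\<Inter>n. ?F n) \<noteq> {}"
      using compact_decseq_subset_open[OF Fc Fd open_empty] Fn by blast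
    then obtain b where "b \<in> L" "b \<in> cball a (e / 2)"
      unfolding L_def by blast
    then show ?thesis
      using e by (intro bexI[of _ b]) auto
  qed
  have ev: "\<exists>N. \<forall>k\<ge>N. \<forall>n\<ge>N. dist (X k) (X n) < e / 2" if "e > 0" for e
    using X that unfolding Cauchy_def by (meson half_gt_zero)
  have L_ne: "L \<noteq> {}"
  proof -
    obtain N where N: "\<And>k n. k \<ge> N \<Longrightarrow> n \<ge> N \<Longrightarrow> dist (X k) (X n) < 1 / 2"
      using ev[of 1] by auto
    obtain a where "a \<in> set_of (X N)"
      using set_of_nonempty by blast
    then have "\<exists>b\<in>set_of (X k). dist a b < 1 / 2" if "k \<ge> N" for k
      using N[OF order_refl that] unfolding dist_hyperspace_less_iff by blast
    then show ?thesis
      using near[of 1 N a] by auto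
  qed
  have "closed L"
    unfolding L_def using Tc by blast
  then have "compact (G \<inter> L)"
    using G by (rule compact_Int_closed[rotated])
  moreover have "G \<inter> L = L"
    using TG[of 0] unfolding L_def by blast
  ultimately have L_comp: "compact L"
    by simp
  have L: "set_of (Abs_hyperspace L) = L"
    using L_comp L_ne by (rule set_of_Abs_hyperspace)
  have "Abs_hyperspace L \<in> hyper_subsets G"
    using \<open>G \<inter> L = L\<close> by (auto simp: hyper_subsets_def L)
  moreover have "X \<longlonglongrightarrow> Abs_hyperspace L"
    unfolding lim_sequentially
  proof (intro allI impI)
    fix e :: real assume e: "e > 0"
    obtain N where N: "\<And>k n. k \<ge> N \<Longrightarrow> n \<ge> N \<Longrightarrow> dist (X k) (X n) < e / 2"
      using ev[OF e] by blast
    have "dist (X n) (Abs_hyperspace L) < e" if n: "n \<ge> N" for n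
      unfolding dist_hyperspace_less_iff L
    proof (intro conjI ballI)
      fix a assume a: "a \<in> set_of (X n)"
      show "\<exists>b\<in>L. dist a b < e"
        by (rule near[OF e, of N]) (use N[OF n] a in \<open>unfold dist_hyperspace_less_iff, blast\<close>)
    next
      \<comment> \<open>A point of \<open>L\<close> is approximated from some later
        \<open>X k\<close>, which the Cauchy property compares with \<open>X n\<close>.\<close>
      fix b assume "b \<in> L"
      then have "b \<in> closure (\<Union>k\<in>{n..}. set_of (X k))"
        by (auto simp: L_def T_def)
      then obtain k c where c: "k \<ge> n" "c \<in> set_of (X k)" "dist c b < e / 2"
        using e unfolding closure_approachable by (metis UN_E atLeast_iff half_gt_zero)
      obtain a where a: "a \<in> set_of (X n)" "dist a c < e / 2"
        using N[of n k] c(1,2) n unfolding dist_hyperspace_less_iff by auto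
      have "dist a b < e"
        using a(2) c(3) dist_triangle[of a b c] by linarith
      with a(1) show "\<exists>a\<in>set_of (X n). dist a b < e"
        by blast
    qed
    then show "\<exists>N. \<forall>n\<ge>N. dist (X n) (Abs_hyperspace L) < e"
      by blast
  qed
  ultimately show "\<exists>l\<in>hyper_subsets G. X \<longlonglongrightarrow> l"
    by blast
qed

lemma compact_hyper_subsets:
  assumes G: "compact G"
  shows "compact (hyper_subsets G)"
  unfolding compact_eq_totally_bounded
proof (intro conjI allI impI)
  show "complete (hyper_subsets G)"
    using G by (rule complete_hyper_subsets)
  fix e :: real assume "e > 0"
  then obtain k where k: "finite k" "G \<subseteq> (\<Union>x\<in>k. ball x e)"
    using G by (auto simp: compact_eq_totally_bounded)
  \<comment> \<open>The subsets of a finite \<open>e\<close>-net of \<open>G\<close> form an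
    \<open>e\<close>-net of the hyperspace. \<open>Abs_hyperspace {}\<close> is unspecified and
    merely adds one harmless ball.\<close>
  have "hyper_subsets G \<subseteq> (\<Union>K\<in>Abs_hyperspace ` Pow k. ball K e)"
  proof
    fix K assume "K \<in> hyper_subsets G"
    then have "set_of K \<subseteq> (\<Union>x\<in>k. ball x e)"
      using k(2) by (auto simp: hyper_subsets_def)
    then obtain s where "s \<subseteq> k" "dist (Abs_hyperspace s) K < e"
      by (rule finite_subset_dist_less[OF k(1)])
    then show "K \<in> (\<Union>K\<in>Abs_hyperspace ` Pow k. ball K e)"
      by auto
  qed
  then show "\<exists>k. finite k \<and> hyper_subsets G \<subseteq> (\<Union>K\<in>k. ball K e)"
    using k(1) by (intro exI[of _ "Abs_hyperspace ` Pow k"]) simp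
qed

section \<open>Connectedness of the hyperspace of a connected set\<close>

lemma continuous_on_insert_hyperspace:
  "continuous_on S (\<lambda>x. Abs_hyperspace (insert x (set_of A)))"
  unfolding continuous_on_iff
proof (intro ballI allI impI)
  fix x and e :: real assume e: "e > 0"
  have s: "set_of (Abs_hyperspace (insert y (set_of A))) = insert y (set_of A)" for y
    by (intro set_of_Abs_hyperspace compact_insert) auto
  \<comment> \<open>The map does not increase distances, so \<open>e\<close> serves as its own
    modulus of continuity.\<close>
  have "dist (Abs_hyperspace (insert y (set_of A))) (Abs_hyperspace (insert x (set_of A))) < e"
    if "dist y x < e" for y
    unfolding dist_hyperspace_less_iff s using that e
    by (metis dist_self insert_iff)
  with e show "\<exists>d>0. \<forall>y\<in>S. dist y x < d \<longrightarrow>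
    dist (Abs_hyperspace (insert y (set_of A))) (Abs_hyperspace (insert x (set_of A))) < e"
    by blast
qed

text \<open>Letting the inserted point range over \<open>G\<close> gives a connected family
  containing \<open>A\<close>, since inserting a point of \<open>A\<close> changes nothing. Adding
  points one by one then joins both \<open>A\<close> and \<open>B\<close> to their union.\<close>

lemma connected_finite_hyper_subsets:
  assumes G: "connected G"
  shows "connected {K \<in> hyper_subsets G. finite (set_of K)}" (is "connected ?F")
proof -
  have step: "connected_component ?F A (Abs_hyperspace (insert x (set_of A)))"
    if A: "A \<in> ?F" and x: "x \<in> G" for A x
  proof (rule connected_componentI)
    let ?T = "(\<lambda>x. Abs_hyperspace (insert x (set_of A))) ` G"
    show "connected ?T"
      using continuous_on_insert_hyperspace G by (rule connected_continuous_image)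
    show "?T \<subseteq> ?F"
      using A by (auto simp: hyper_subsets_def set_of_Abs_hyperspace)
    show "Abs_hyperspace (insert x (set_of A)) \<in> ?T"
      using x by blast
    obtain a where a: "a \<in> set_of A"
      using set_of_nonempty by blast
    then have "A = Abs_hyperspace (insert a (set_of A))"
      by (simp add: insert_absorb set_of_inverse)
    then show "A \<in> ?T"
      using a A by (auto simp: hyper_subsets_def)
  qed
  have union: "connected_component ?F A (Abs_hyperspace (set_of A \<union> C))"
    if A: "A \<in> ?F" and C: "finite C" "C \<subseteq> G" for A C
    using C
  proof (induction C rule: finite_induct)
    case empty
    then show ?case
      using A by (simp add: set_of_inverse connected_component_refl)
  next
    case (insert x C)
    let ?B = "Abs_hyperspace (set_of A \<union> C)"
    have B: "set_of ?B = set_of A \<union> C"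
      using insert.hyps
      by (intro set_of_Abs_hyperspace compact_Un compact_set_of finite_imp_compact) auto
    have "connected_component ?F A ?B"
      using insert by simp
    moreover have "connected_component ?F ?B (Abs_hyperspace (insert x (set_of ?B)))"
      using insert A by (intro step) (auto simp: hyper_subsets_def B)
    ultimately show ?case
      unfolding B Un_insert_right by (rule connected_component_trans)
  qed
  have "connected_component ?F A B" if "A \<in> ?F" "B \<in> ?F" for A B
  proof -
    have "connected_component ?F A (Abs_hyperspace (set_of A \<union> set_of B))"
      using that by (intro union) (simp_all add: hyper_subsets_def)
    moreover have "connected_component ?F B (Abs_hyperspace (set_of A \<union> set_of B))"
      using that union[of B "set_of A"] by (simp add: hyper_subsets_def Un_commute)
    ultimately show ?thesis
      using connected_component_sym connected_component_trans by blast
  qed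
  then show ?thesis
    by (simp add: connected_iff_connected_component)
qed

text \<open>Finite subsets are dense: a finite net of \<open>K\<close> chosen inside
  \<open>K\<close> stays in \<open>G\<close>. A set between a connected set and its closure is
  connected.\<close>

lemma connected_hyper_subsets:
  assumes G: "connected G"
  shows "connected (hyper_subsets G)"
proof (rule connected_intermediate_closure[OF connected_finite_hyper_subsets[OF G]])
  show "hyper_subsets G \<subseteq> closure {K \<in> hyper_subsets G. finite (set_of K)}"
  proof
    fix K assume K: "K \<in> hyper_subsets G"
    show "K \<in> closure {K \<in> hyper_subsets G. finite (set_of K)}"
      unfolding closure_approachable
    proof (intro allI impI)
      fix e :: real assume "e > 0"
      then obtain k where k: "finite k" "k \<subseteq> set_of K" "set_of K \<subseteq> (\<Union>x\<in>k. ball x e)"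
        using seq_compact_imp_totally_bounded compact_set_of compact_imp_seq_compact by metis
      obtain s where s: "s \<subseteq> k" "s \<noteq> {}" "finite s" "dist (Abs_hyperspace s) K < e"
        by (rule finite_subset_dist_less[OF k(1,3)])
      then have "Abs_hyperspace s \<in> {K \<in> hyper_subsets G. finite (set_of K)}"
        using K k(2) by (auto simp: hyper_subsets_def set_of_Abs_hyperspace finite_imp_compact)
      with s(4) show "\<exists>L\<in>{K \<in> hyper_subsets G. finite (set_of K)}. dist L K < e"
        by blast
    qed
  qed
qed auto

section \<open>The Hutchinson map\<close>

lemma set_of_funpow_hutchinson_map:
  assumes "IFS m f"
  shows "set_of ((hutchinson_map m f ^^ n) K) = (hutchinson m f ^^ n) (set_of K)"
  by (induction n) (simp_all add: set_of_hutchinson_map[OF assms])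

lemma funpow_hutchinson_UN:
  "(hutchinson m f ^^ n) (\<Union>K\<in>\<K>. A K) = (\<Union>K\<in>\<K>. (hutchinson m f ^^ n) (A K))"
  unfolding funpow_hutchinson by auto

lemma attracts_hyper_subsets:
  assumes F: "IFS m f" and G: "compact G" and attr: "attracts m f G (\<Union>K\<in>\<K>. set_of K)"
  shows "attracts 1 (\<lambda>_. hutchinson_map m f) (hyper_subsets G) \<K>"
  unfolding attracts_single_iff
proof (intro allI impI)
  fix \<epsilon> :: real assume \<epsilon>: "\<epsilon> > 0"
  let ?h = "hutchinson_map m f"
  obtain N where N: "\<And>n. n \<ge> N \<Longrightarrow> (hutchinson m f ^^ n) (\<Union>K\<in>\<K>. set_of K) \<subseteq> nbhd (\<epsilon> / 2) G"
    using attr \<epsilon> unfolding attracts_iff_funpow by (meson half_gt_zero)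
  have "(?h ^^ n) K \<in> nbhd \<epsilon> (hyper_subsets G)" if n: "n \<ge> N" and K: "K \<in> \<K>" for n K
  proof -
    let ?K = "(?h ^^ n) K"
    have "set_of ?K \<subseteq> nbhd (\<epsilon> / 2) G"
      using N[OF n] K unfolding set_of_funpow_hutchinson_map[OF F] funpow_hutchinson_UN by blast
    then have near: "\<exists>g\<in>G. dist x g < \<epsilon> / 2" if "x \<in> set_of ?K" for x
      using that by (auto simp: nbhd_iff)
    \<comment> \<open>\<open>B\<close> is the part of \<open>G\<close> near \<open>?K\<close>. The
      non-strict inequality makes it closed, and the radius \<open>\<epsilon> / 2\<close> still
      gives strict bounds by \<open>\<epsilon>\<close>.\<close>
    define B where "B = {g \<in> G. infdist g (set_of ?K) \<le> \<epsilon> / 2}"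
    have "B = G \<inter> {g. infdist g (set_of ?K) \<le> \<epsilon> / 2}"
      by (auto simp: B_def)
    moreover have "closed {g. infdist g (set_of ?K) \<le> \<epsilon> / 2}"
      by (intro closed_Collect_le continuous_intros)
    ultimately have "compact B"
      using G by (simp add: compact_Int_closed)
    have 1: "\<exists>b\<in>B. dist x b < \<epsilon>" if x: "x \<in> set_of ?K" for x
    proof -
      obtain g where g: "g \<in> G" "dist x g < \<epsilon> / 2"
        using near[OF x] by blast
      have "infdist g (set_of ?K) \<le> \<epsilon> / 2"
        using infdist_le[OF x, of g] g(2) by (simp add: dist_commute)
      then show ?thesis
        using g \<epsilon> by (intro bexI[of _ g]) (auto simp: B_def)
    qed
    then have "B \<noteq> {}"
      using set_of_nonempty[of ?K] by blast
    have 2: "\<exists>x\<in>set_of ?K. dist x b < \<epsilon>" if "b \<in> B" for b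
    proof -
      have "infdist b (set_of ?K) < \<epsilon>"
        using that \<epsilon> by (simp add: B_def)
      then show ?thesis
        by (simp add: infdist_less_iff dist_commute)
    qed
    have B: "set_of (Abs_hyperspace B) = B"
      using \<open>compact B\<close> \<open>B \<noteq> {}\<close> by (rule set_of_Abs_hyperspace)
    have "dist ?K (Abs_hyperspace B) < \<epsilon>"
      unfolding dist_hyperspace_less_iff B using 1 2 by blast
    moreover have "Abs_hyperspace B \<in> hyper_subsets G"
      unfolding hyper_subsets_def using B by (auto simp: B_def)
    ultimately show ?thesis
      unfolding nbhd_iff by blast
  qed
  then show "\<exists>N. \<forall>n\<ge>N. (?h ^^ n) ` \<K> \<subseteq> nbhd \<epsilon> (hyper_subsets G)"
    by blast
qed

section \<open>Passing between attractors of the system and of its Hutchinson map\<close>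

lemma compact_dynamics_hutchinson_map:
  assumes F: "IFS m f" and G: "global_attractor m f G"
  shows "compact_dynamics 1 (\<lambda>_. hutchinson_map m f)"
proof -
  have "continuous_on UNIV (hutchinson_map m f)"
    using IFS_hutchinson_map[OF F] by (simp add: IFS_def)
  moreover have "compact (hyper_subsets G)"
    using G by (intro compact_hyper_subsets) (simp add: global_attractor_def)
  moreover have "hutchinson_map m f ` hyper_subsets G \<subseteq> hyper_subsets G"
    using G monoD[OF mono_hutchinson, of _ G m f]
    by (simp add: hyper_subsets_def set_of_hutchinson_map[OF F] global_attractor_def image_subset_iff)
  moreover have "attracts 1 (\<lambda>_. hutchinson_map m f) (hyper_subsets G) \<K>" if "compact \<K>" for \<K>
    using G compact_UN_set_of[OF that]
    by (intro attracts_hyper_subsets[OF F]) (auto simp: global_attractor_def)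
  ultimately show ?thesis
    unfolding compact_dynamics_def using global_attractor_INT by blast
qed

lemma hutchinson_UN_invariant:
  assumes F: "IFS m f" and inv: "hutchinson_map m f ` \<H> = \<H>"
  shows "hutchinson m f (\<Union>A\<in>\<H>. set_of A) = (\<Union>A\<in>\<H>. set_of A)"
proof -
  have "hutchinson m f (\<Union>A\<in>\<H>. set_of A) = (\<Union>A\<in>\<H>. set_of (hutchinson_map m f A))"
    unfolding set_of_hutchinson_map[OF F] by (auto simp: hutchinson_def)
  also have "\<dots> = (\<Union>A\<in>hutchinson_map m f ` \<H>. set_of A)"
    by simp
  finally show ?thesis
    by (simp only: inv)
qed

lemma global_attractor_UN_set_of:
  assumes F: "IFS m f" and H: "global_attractor 1 (\<lambda>_. hutchinson_map m f) \<H>"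
  shows "global_attractor m f (\<Union>A\<in>\<H>. set_of A)"
  unfolding global_attractor_def
proof (intro conjI allI impI)
  have "compact \<H>" and inv: "hutchinson_map m f ` \<H> = \<H>"
    and attr: "\<And>\<K>. compact \<K> \<Longrightarrow> attracts 1 (\<lambda>_. hutchinson_map m f) \<H> \<K>"
    using H unfolding global_attractor_single_iff by blast+
  then show "compact (\<Union>A\<in>\<H>. set_of A)"
    by (simp add: compact_UN_set_of)
  show "hutchinson m f (\<Union>A\<in>\<H>. set_of A) = (\<Union>A\<in>\<H>. set_of A)"
    using F inv by (rule hutchinson_UN_invariant)
  fix K :: "'a set" assume K: "compact K"
  show "attracts m f (\<Union>A\<in>\<H>. set_of A) K"
  \<comment> \<open>The empty set is not a point of the hyperspace and is treated apart.\<close>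
  proof (cases "K = {}")
    case True
    then show ?thesis
      by (auto simp: attracts_def)
  next
    case False
    have sK: "set_of (Abs_hyperspace K) = K"
      using K False by (rule set_of_Abs_hyperspace)
    show ?thesis
      unfolding attracts_iff_funpow
    proof (intro allI impI)
      fix \<epsilon> :: real assume "\<epsilon> > 0"
      \<comment> \<open>Attraction in the hyperspace is applied to the one-element family consisting
        of \<open>K\<close>.\<close>
      then obtain N where
        N: "\<And>n. n \<ge> N \<Longrightarrow> (hutchinson_map m f ^^ n) (Abs_hyperspace K) \<in> nbhd \<epsilon> \<H>"
        using attr[of "{Abs_hyperspace K}"] unfolding attracts_single_iff by auto
      have "(hutchinson m f ^^ n) K \<subseteq> nbhd \<epsilon> (\<Union>A\<in>\<H>. set_of A)" if "n \<ge> N" for n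
        using N[OF that]
        by (fastforce simp: nbhd_iff dist_hyperspace_less_iff set_of_funpow_hutchinson_map[OF F] sK)
      then show "\<exists>N. \<forall>n\<ge>N. (hutchinson m f ^^ n) K \<subseteq> nbhd \<epsilon> (\<Union>A\<in>\<H>. set_of A)"
        by blast
    qed
  qed
qed

section \<open>Relations between the two attractors\<close>

lemma global_attractor_unique:
  assumes "global_attractor m f A" "global_attractor m f B"
  shows "A = B"
  using assms invariant_subset_attracting[of A m f B] invariant_subset_attracting[of B m f A]
  by (auto simp: global_attractor_def compact_imp_closed)

text \<open>The distance to the empty set is infinite, so its neighbourhoods are empty, whereas
  iterates of a point are not. This makes \<open>G\<close> a point of the hyperspace.\<close>

lemma global_attractor_nonempty:
  assumes F: "IFS m f" and G: "global_attractor m f G"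
  shows "G \<noteq> {}"
proof
  assume "G = {}"
  then have "attracts m f {} {undefined}"
    using G by (simp add: global_attractor_def)
  then obtain N where "(hutchinson m f ^^ N) {undefined} \<subseteq> nbhd 1 {}"
    unfolding attracts_iff_funpow by (meson order_refl zero_less_one)
  then have "(hutchinson m f ^^ N) {undefined} = {}"
    by (auto simp: nbhd_iff)
  moreover have "set_of (Abs_hyperspace {undefined :: 'a}) = {undefined}"
    by (simp add: set_of_Abs_hyperspace)
  ultimately show False
    using set_of_funpow_hutchinson_map[OF F, of N "Abs_hyperspace {undefined}"] by simp
qed

text \<open>As a fixed point of the Hutchinson map, \<open>G\<close> forms an invariant singleton,
  which the closed attracting set \<H> must contain.\<close>

lemma global_attractor_mem:
  assumes F: "IFS m f" and G: "global_attractor m f G"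
    and H: "global_attractor 1 (\<lambda>_. hutchinson_map m f) \<H>"
  shows "G \<in> set_of ` \<H>"
proof -
  have sG: "set_of (Abs_hyperspace G) = G"
    using G global_attractor_nonempty[OF F G]
    by (intro set_of_Abs_hyperspace) (simp_all add: global_attractor_def)
  have "hutchinson_map m f (Abs_hyperspace G) = Abs_hyperspace G"
    unfolding hutchinson_map_def sG using G by (simp add: global_attractor_def)
  then have "hutchinson 1 (\<lambda>_. hutchinson_map m f) {Abs_hyperspace G} = {Abs_hyperspace G}"
    unfolding hutchinson_single by simp
  then have "{Abs_hyperspace G} \<subseteq> \<H>"
    using H by (intro invariant_subset_attracting)
      (auto simp: global_attractor_def compact_imp_closed)
  with sG show ?thesis
    by (metis image_eqI insert_subset)
qed

section \<open>Connectedness of the attractor\<close>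

lemma connected_global_attractor_single:
  assumes h: "continuous_on UNIV h" and A: "global_attractor 1 (\<lambda>_. h) A"
    and C: "compact C" "connected C" "A \<subseteq> C"
  shows "connected A"
proof (rule connectedI)
  have inv: "h ` A = A" and "compact A" and attr: "attracts 1 (\<lambda>_. h) A C"
    using A C(1) by (simp_all only: global_attractor_single_iff)
  fix U V
  assume UV: "open U" "open V" "U \<inter> A \<noteq> {}" "V \<inter> A \<noteq> {}" "U \<inter> V \<inter> A = {}" "A \<subseteq> U \<union> V"
  \<comment> \<open>\<open>U\<close> and \<open>V\<close> are disjoint only within \<open>A\<close>.
    Normality replaces them by disjoint open sets \<open>P\<close> and \<open>Q\<close>, which
    separate a late image of \<open>C\<close> as soon as that image lies in their union.\<close>
  have "closed (A - U)" "closed (A - V)"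
    using \<open>compact A\<close> UV(1,2) by (auto intro: compact_imp_closed compact_diff)
  moreover have "(A - U) \<inter> (A - V) = {}"
    using UV(6) by blast
  ultimately obtain P Q where PQ: "open P" "open Q" "A - U \<subseteq> P" "A - V \<subseteq> Q" "P \<inter> Q = {}"
    using t4_space by metis
  have "A \<subseteq> P \<union> Q"
    using PQ UV(5) by blast
  then obtain e where e: "e > 0" "(\<Union>x\<in>A. ball x e) \<subseteq> P \<union> Q"
    using compact_subset_open_imp_ball_epsilon_subset[OF \<open>compact A\<close>] PQ(1,2) open_Un by metis
  obtain N where "(h ^^ N) ` C \<subseteq> nbhd e A"
    using attr e(1) unfolding attracts_single_iff by blast
  moreover have "nbhd e A = (\<Union>x\<in>A. ball x e)"
    by (auto simp: nbhd_iff dist_commute)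
  ultimately have sub: "(h ^^ N) ` C \<subseteq> P \<union> Q"
    using e(2) by blast
  have "(h ^^ N) ` A = A"
    using inv by (induction N) (simp_all flip: image_image)
  then have sup: "A \<subseteq> (h ^^ N) ` C"
    using C(3) by blast
  have "connected ((h ^^ N) ` C)"
    using continuous_on_funpow[OF h] C(2)
    by (blast intro: connected_continuous_image continuous_on_subset)
  moreover have "P \<inter> (h ^^ N) ` C \<noteq> {}" "Q \<inter> (h ^^ N) ` C \<noteq> {}"
    using UV(3-5) PQ(3,4) sup by blast+
  ultimately show False
    using connectedD[of "(h ^^ N) ` C" P Q] PQ(1,2,5) sub by blast
qed

theorem theorem9:
  fixes m :: nat and f :: "nat \<Rightarrow> 'a::metric_space \<Rightarrow> 'a"
  assumes "separable_space (euclidean :: 'a topology)"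
    and "locally_compact_space (euclidean :: 'a topology)"
    and "IFS m f"
  shows "(compact_dynamics m f \<longleftrightarrow> compact_dynamics 1 (\<lambda>_. hutchinson_map m f)) \<and>
    (\<forall>G \<H>. global_attractor m f G \<longrightarrow> global_attractor 1 (\<lambda>_. hutchinson_map m f) \<H> \<longrightarrow>
       G \<in> set_of ` \<H> \<and> \<H> \<subseteq> hyper_subsets G \<and>
       G = (\<Union>A\<in>\<H>. set_of A) \<and>
       (connected G \<longrightarrow> connected \<H>))"
proof (intro conjI allI impI iffI)
  note F = assms(3)
  show "compact_dynamics 1 (\<lambda>_. hutchinson_map m f)" if "compact_dynamics m f"
    using that compact_dynamics_hutchinson_map[OF F] by (auto simp: compact_dynamics_def)
  show "compact_dynamics m f" if "compact_dynamics 1 (\<lambda>_. hutchinson_map m f)"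
    using that global_attractor_UN_set_of[OF F] unfolding compact_dynamics_def by blast
  fix G \<H>
  assume G: "global_attractor m f G" and H: "global_attractor 1 (\<lambda>_. hutchinson_map m f) \<H>"
  show "G \<in> set_of ` \<H>"
    using F G H by (rule global_attractor_mem)
  \<comment> \<open>Both sides are global attractors of the system, so uniqueness applies.\<close>
  show eq: "G = (\<Union>A\<in>\<H>. set_of A)"
    using G global_attractor_UN_set_of[OF F H] by (rule global_attractor_unique)
  then show sub: "\<H> \<subseteq> hyper_subsets G"
    by (auto simp: hyper_subsets_def)
  assume conn: "connected G"
  have "continuous_on UNIV (hutchinson_map m f)"
    using IFS_hutchinson_map[OF F] by (simp add: IFS_def)
  moreover have "compact (hyper_subsets G)"
    using G by (intro compact_hyper_subsets) (simp add: global_attractor_def)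
  ultimately show "connected \<H>"
    by (rule connected_global_attractor_single[OF _ H _ connected_hyper_subsets[OF conn] sub])
qed

end
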